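(* Let $n\in\mathbb{N}$, $d\in\mathbb{N}_0$, let $K\subseteq\mathbb{R}^n$ be closed with $\mathrm{int}\,K\neq\emptyset$, and let $S\subseteq\mathrm{Pos}(K)_{\leq 2d}$. Then the following statements hold: (i) There exist a linear operator $A:\mathbb{R}[x_1,\dots,x_n]_{\leq 2d}\to\mathbb{R}[x_1,\dots,x_n]_{\leq 2d}$ and a constant $\tau\geq 0$ such that \[e^{tA}S\subseteq\sum\mathbb{R}[x_1,\dots,x_n]_{\leq d}^2\qquad\text{for all } t\geq\tau.\] (ii) Let $f\in\mathrm{int}\sum\mathbb{R}[x_1,\dots,x_n]_{\leq d}^2$ and let \[l:\mathbb{R}[x_1,\dots,x_n]_{\leq 2d}\to\mathbb{R},\quad l(p):=\int_K p(x)\cdot e^{-x^2}\,\mathrm{d}x.\] Then the operator $A:\mathbb{R}[x_1,\dots,x_n]_{\leq 2d}\to\mathbb{R}[x_1,\dots,x_n]_{\leq 2d}$, $p\mapsto Ap:=l(p)\cdot f$, is an operator as in (i), i.e. there is a constant $\tau\geq 0$ with $e^{tA}S\subseteq\sum\mathbb{R}[x_1,\dots,x_n]_{\leq d}^2$ for all $t\geq\tau$. (iii) Let $L:\mathbb{R}[x_1,\dots,x_n]_{\leq 2d}\to\mathbb{R}$ be a linear functional and let $A$ (with constant $\tau$) be an operator as in (i). Set $\tilde S:=e^{\tau A}S\subseteq\sum\mathbb{R}[x_1,\dots,x_n]_{\leq d}^2$ and $\tilde L:\mathbb{R}[x_1,\dots,x_n]_{\leq 2d}\to\mathbb{R}$,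 $\tilde L(p):=L(e^{-\tau A}p)$. Then \[\inf_{p\in S}L(p)=\inf_{p\in\tilde S}\tilde L(p)\qquad\text{and}\qquad\sup_{p\in S}L(p)=\sup_{p\in\tilde S}\tilde L(p).\]
   Context: $\mathbb{R}[x_1,\dots,x_n]_{\leq m}$ is the finite dimensional real vector space of polynomials of total degree at most $m$. $\mathrm{Pos}(K)_{\leq 2d}$ is the set of $f\in\mathbb{R}[x_1,\dots,x_n]_{\leq 2d}$ with $f(x)\geq 0$ for all $x\in K$. $\sum\mathbb{R}[x_1,\dots,x_n]_{\leq d}^2\subseteq\mathbb{R}[x_1,\dots,x_n]_{\leq 2d}$ is the cone of finite sums of squares of polynomials of degree at most $d$; its interior is taken in $\mathbb{R}[x_1,\dots,x_n]_{\leq 2d}$. $e^{-x^2}$ means $e^{-(x_1^2+\dots+x_n^2)}$, and $\mathrm{d}x$ is Lebesgue measure. $e^{tA}$ is the usual exponential of an endomorphism of a finite dimensional space. Infima and suprema are taken in $[-\infty,\infty]$. *)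

theory Defs
  imports "HOL-Analysis.Analysis" "HOL-Analysis.Finite_Function_Topology"
begin

text \<open>Real polynomials in finitely many variables indexed by \<^typ>\<open>'n\<close> (so \<open>n = CARD('n)\<close>), as
  finitely supported coefficient functions on exponent vectors. The library equips this type with
  its ring structure and with the \<open>l1\<close> norm of the coefficients; on each of the finite dimensional
  subspaces below, this norm induces the unique Hausdorff vector space topology.\<close>

type_synonym 'n rpoly = "('n \<Rightarrow>\<^sub>0 nat) \<Rightarrow>\<^sub>0 real"

definition poly_eval :: "'n::finite rpoly \<Rightarrow> real ^ 'n \<Rightarrow> real" where
  "poly_eval p x =
     (\<Sum>a\<in>Poly_Mapping.keys p. Poly_Mapping.lookup p a * (\<Prod>i\<in>UNIV. (x $ i) ^ Poly_Mapping.lookup a i))"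

definition monom_degree :: "('n::finite \<Rightarrow>\<^sub>0 nat) \<Rightarrow> nat" where
  "monom_degree a = (\<Sum>i\<in>UNIV. Poly_Mapping.lookup a i)"

definition polys_le :: "nat \<Rightarrow> 'n::finite rpoly set" where
  "polys_le m = {p. \<forall>a\<in>Poly_Mapping.keys p. monom_degree a \<le> m}"

definition Pos_le :: "(real ^ 'n) set \<Rightarrow> nat \<Rightarrow> 'n::finite rpoly set" where
  "Pos_le K m = {f \<in> polys_le m. \<forall>x\<in>K. 0 \<le> poly_eval f x}"

definition sos :: "nat \<Rightarrow> 'n::finite rpoly set" where
  "sos d = {(\<Sum>q\<leftarrow>qs. q\<^sup>2) | qs. set qs \<subseteq> polys_le d}"

definition int_sos :: "nat \<Rightarrow> 'n::finite rpoly set" where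
  "int_sos d = (top_of_set (polys_le (2 * d))) interior_of (sos d)"

text \<open>The degree bound is a term, so the space of polynomials of bounded degree is a subset and not
  a type. A linear map on it is a total function whose values off that subset are irrelevant.\<close>

definition linear_on :: "'a::real_vector set \<Rightarrow> 'b::real_vector set \<Rightarrow> ('a \<Rightarrow> 'b) \<Rightarrow> bool" where
  "linear_on V W f \<longleftrightarrow>
     f ` V \<subseteq> W \<and>
     (\<forall>x\<in>V. \<forall>y\<in>V. f (x + y) = f x + f y) \<and>
     (\<forall>c. \<forall>x\<in>V. f (c *\<^sub>R x) = c *\<^sub>R f x)"

text \<open>The exponential series of an endomorphism, summed pointwise; in finite dimension this agrees
  with summation in operator norm. It is only meant for \<open>B\<close> linear on a finite dimensional
  subspace and for \<open>p\<close> in that subspace, where the series converges.\<close>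

definition op_exp :: "('a::real_normed_vector \<Rightarrow> 'a) \<Rightarrow> 'a \<Rightarrow> 'a" where
  "op_exp B p = suminf (\<lambda>k. (1 / fact k) *\<^sub>R (B ^^ k) p)"

definition moves_into_sos :: "nat \<Rightarrow> 'n::finite rpoly set \<Rightarrow> ('n rpoly \<Rightarrow> 'n rpoly) \<Rightarrow> real \<Rightarrow> bool" where
  "moves_into_sos d S A \<tau> \<longleftrightarrow>
     linear_on (polys_le (2 * d)) (polys_le (2 * d)) A \<and>
     0 \<le> \<tau> \<and>
     (\<forall>t\<ge>\<tau>. op_exp (\<lambda>p. t *\<^sub>R A p) ` S \<subseteq> sos d)"

definition gauss_functional :: "(real ^ 'n) set \<Rightarrow> 'n::finite rpoly \<Rightarrow> real" where
  "gauss_functional K p = (LINT x:K|lborel. poly_eval p x * exp (- (\<Sum>i\<in>UNIV. (x $ i)\<^sup>2)))"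

end

theory Submission
  imports Defs "HOL-Probability.Distributions"
begin

text \<open>For \<open>A p = l(p) f\<close> the exponential series gives
  \<open>e\<^sup>t\<^sup>A p = p + c(t) l(p) f\<close> with \<open>c(t) = (e\<^bsup>t l(f)\<^esup> - 1) / l(f)\<close>, which is at least \<open>t\<close>. The
  functional \<open>l\<close> is positive on nonzero polynomials that are nonnegative on \<open>K\<close>, because a polynomial
  vanishing on an open set is zero; by compactness of the unit sphere, \<open>norm p \<le> C l(p)\<close> for these
  polynomials. So \<open>f + p / (c(t) l(p))\<close> lies in a fixed neighbourhood of the interior point \<open>f\<close> as soon
  as \<open>t\<close> is large, uniformly in \<open>p\<close>. Claim (iii) only needs that \<open>e\<^bsup>-B\<^esup>\<close> inverts \<open>e\<^sup>B\<close>. The ambient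
  space of all polynomials is not complete, so this is checked coefficientwise, rearranging the double
  series along its diagonals.\<close>

subsection \<open>Finitely supported functions\<close>

lemma lookup_scaleR [simp]:
  "Poly_Mapping.lookup (c *\<^sub>R p) k = c *\<^sub>R Poly_Mapping.lookup p k"
proof -
  have "finite {k. c *\<^sub>R Poly_Mapping.lookup p k \<noteq> 0}"
    by (rule finite_subset[OF _ finite_lookup[of p]]) auto
  then show ?thesis
    by (simp add: scaleR_poly_mapping_def lookup_Abs_poly_mapping)
qed

lemma keys_scaleR_subset: "Poly_Mapping.keys (c *\<^sub>R p) \<subseteq> Poly_Mapping.keys p"
  by (auto simp: in_keys_iff)

lemma norm_poly_mapping_eq_sum:
  assumes "finite M" "Poly_Mapping.keys p \<subseteq> M"
  shows "norm p = (\<Sum>k\<in>M. norm (Poly_Mapping.lookup p k))"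
proof -
  have "norm p = (\<Sum>k\<in>Poly_Mapping.keys p. norm (Poly_Mapping.lookup p k))"
    by (simp add: norm_poly_mapping_def dist_poly_mapping_def)
  also have "\<dots> = (\<Sum>k\<in>M. norm (Poly_Mapping.lookup p k))"
    using assms by (intro sum.mono_neutral_left) (auto simp: in_keys_iff)
  finally show ?thesis .
qed

lemma norm_lookup_le: "norm (Poly_Mapping.lookup p k) \<le> norm p"
proof -
  have "norm (Poly_Mapping.lookup p k) \<le>
      (\<Sum>k\<in>insert k (Poly_Mapping.keys p). norm (Poly_Mapping.lookup p k))"
    by (intro member_le_sum) auto
  then show ?thesis
    by (subst norm_poly_mapping_eq_sum[of "insert k (Poly_Mapping.keys p)"]) auto
qed

lemma bounded_linear_lookup: "bounded_linear (\<lambda>p. Poly_Mapping.lookup p k)"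
  by (rule bounded_linear_intro[where K = 1]) (auto simp: lookup_add norm_lookup_le)

lemma scaleR_single: "c *\<^sub>R Poly_Mapping.single k x = Poly_Mapping.single k (c *\<^sub>R x)"
  by (rule poly_mapping_eqI) (simp add: lookup_single when_def)

lemma scaleR_single_one:
  fixes c :: real
  shows "c *\<^sub>R Poly_Mapping.single k 1 = Poly_Mapping.single k c"
  by (simp add: scaleR_single)

lemma poly_mapping_eq_sum_single:
  assumes "finite M" "Poly_Mapping.keys p \<subseteq> M"
  shows "p = (\<Sum>k\<in>M. Poly_Mapping.single k (Poly_Mapping.lookup p k))"
proof (rule poly_mapping_eqI)
  fix j
  have "Poly_Mapping.lookup (\<Sum>k\<in>M. Poly_Mapping.single k (Poly_Mapping.lookup p k)) j
      = (\<Sum>k\<in>M. if k = j then Poly_Mapping.lookup p k else 0)"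
    by (simp add: lookup_sum lookup_single when_def)
  also have "\<dots> = Poly_Mapping.lookup p j"
    using assms by (auto simp: in_keys_iff)
  finally show "Poly_Mapping.lookup p j =
    Poly_Mapping.lookup (\<Sum>k\<in>M. Poly_Mapping.single k (Poly_Mapping.lookup p k)) j" ..
qed

lemma keys_sum_single_subset:
  assumes "finite M"
  shows "Poly_Mapping.keys (\<Sum>k\<in>M. Poly_Mapping.single k (f k)) \<subseteq> M"
proof
  fix j assume "j \<in> Poly_Mapping.keys (\<Sum>k\<in>M. Poly_Mapping.single k (f k))"
  then have "(\<Sum>k\<in>M. if k = j then f k else 0) \<noteq> 0"
    by (simp add: in_keys_iff lookup_sum lookup_single when_def)
  then show "j \<in> M"
    using assms by (auto split: if_splits)
qed

text \<open>The ambient space is infinite dimensional, so closed and bounded does not give compact.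
  The sphere is instead cut by a closed condition out of a continuous image of a product of compact
  intervals, compact by Tychonoff.\<close>

lemma compact_unit_sphere_supported:
  assumes "finite M"
  shows "compact {p :: 'k \<Rightarrow>\<^sub>0 real. Poly_Mapping.keys p \<subseteq> M \<and> norm p = 1}"
proof -
  \<comment> \<open>The factor \<open>{0}\<close> off \<open>M\<close> encodes the support
    condition; inside \<open>M\<close> the interval from -1 to 1 is large enough because a
    coefficient is bounded by the norm.\<close>
  define X where "X = (\<lambda>k. if k \<in> M then {-1..1} else {0::real})"
  define \<Phi> where "\<Phi> = (\<lambda>c :: 'k \<Rightarrow> real. \<Sum>k\<in>M. c k *\<^sub>R Poly_Mapping.single k (1::real))"
  have "compactin (product_topology (\<lambda>_. euclidean) UNIV) (PiE UNIV X)"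
    unfolding compactin_PiE by (auto simp: X_def)
  then have "compact (PiE UNIV X)"
    by (simp add: euclidean_product_topology)
  moreover have "continuous_on UNIV \<Phi>"
    unfolding \<Phi>_def by (intro continuous_on_sum continuous_on_scaleR continuous_on_product_coordinates
        continuous_on_const)
  ultimately have "compact (\<Phi> ` PiE UNIV X)"
    by (meson compact_continuous_image continuous_on_subset subset_UNIV)
  moreover have "closed {p :: 'k \<Rightarrow>\<^sub>0 real. norm p = 1}"
    by (intro closed_Collect_eq continuous_intros)
  ultimately have "compact (\<Phi> ` PiE UNIV X \<inter> {p. norm p = 1})"
    by (rule compact_Int_closed)
  also have "\<Phi> ` PiE UNIV X \<inter> {p. norm p = 1} = {p. Poly_Mapping.keys p \<subseteq> M \<and> norm p = 1}"
  proof (intro equalityI subsetI)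
    fix p assume "p \<in> \<Phi> ` PiE UNIV X \<inter> {p. norm p = 1}"
    then show "p \<in> {p. Poly_Mapping.keys p \<subseteq> M \<and> norm p = 1}"
      using keys_sum_single_subset[OF assms] by (auto simp: \<Phi>_def scaleR_single_one)
  next
    fix p :: "'k \<Rightarrow>\<^sub>0 real" assume p: "p \<in> {p. Poly_Mapping.keys p \<subseteq> M \<and> norm p = 1}"
    then have "p = \<Phi> (Poly_Mapping.lookup p)"
      using poly_mapping_eq_sum_single[OF assms, of p] by (simp add: \<Phi>_def scaleR_single_one)
    moreover have "Poly_Mapping.lookup p k \<in> X k" for k
      using p norm_lookup_le[of p k] by (auto simp: X_def in_keys_iff)
    ultimately show "p \<in> \<Phi> ` PiE UNIV X \<inter> {p. norm p = 1}"
      using p by (metis (mono_tags, lifting) Int_iff PiE_UNIV_domain UNIV_I image_eqI mem_Collect_eq Pi_I)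
  qed
  finally show ?thesis .
qed

section \<open>Linear maps on the span of finitely many monomials\<close>

lemma linear_on_supported_eq_sum:
  fixes B :: "('k \<Rightarrow>\<^sub>0 real) \<Rightarrow> 'b::real_vector"
  assumes "finite M" and B: "linear_on {p. Poly_Mapping.keys p \<subseteq> M} W B"
    and p: "Poly_Mapping.keys p \<subseteq> M"
  shows "B p = (\<Sum>k\<in>M. Poly_Mapping.lookup p k *\<^sub>R B (Poly_Mapping.single k 1))"
proof -
  have add: "B (p + q) = B p + B q" if "Poly_Mapping.keys p \<subseteq> M" "Poly_Mapping.keys q \<subseteq> M" for p q
    using B that by (simp add: linear_on_def)
  have scale: "B (c *\<^sub>R p) = c *\<^sub>R B p" if "Poly_Mapping.keys p \<subseteq> M" for c p
    using B that by (simp add: linear_on_def)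
  have zero: "B 0 = 0"
    using scale[of 0 0] by simp
  \<comment> \<open>Additivity of \<open>B\<close> is available only inside the subspace; the
    induction keeps \<open>N \<subseteq> M\<close> so that every partial sum is known to lie
    there.\<close>
  have "B (\<Sum>k\<in>N. Poly_Mapping.single k (f k)) = (\<Sum>k\<in>N. f k *\<^sub>R B (Poly_Mapping.single k 1))"
    if "N \<subseteq> M" for N f
    using finite_subset[OF that \<open>finite M\<close>] that
  proof (induction N rule: finite_induct)
    case (insert k N)
    have "Poly_Mapping.keys (\<Sum>k\<in>N. Poly_Mapping.single k (f k)) \<subseteq> M"
      using keys_sum_single_subset[of N f] insert by auto
    moreover have "B (Poly_Mapping.single k (f k)) = f k *\<^sub>R B (Poly_Mapping.single k 1)"
      using scale[of "Poly_Mapping.single k 1" "f k"] insert by (simp add: scaleR_single_one)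
    ultimately show ?case
      using insert by (simp add: add)
  qed (simp add: zero)
  then show ?thesis
    using poly_mapping_eq_sum_single[OF \<open>finite M\<close> p] by (metis order_refl)
qed

lemma linear_on_supported_bounded:
  fixes B :: "('k \<Rightarrow>\<^sub>0 real) \<Rightarrow> 'b::real_normed_vector"
  assumes "finite M" and B: "linear_on {p. Poly_Mapping.keys p \<subseteq> M} W B"
  obtains C where "0 \<le> C" "\<And>p. Poly_Mapping.keys p \<subseteq> M \<Longrightarrow> norm (B p) \<le> C * norm p"
proof -
  define C where "C = (\<Sum>k\<in>M. norm (B (Poly_Mapping.single k 1)))"
  have "norm (B p) \<le> C * norm p" if "Poly_Mapping.keys p \<subseteq> M" for p
  proof -
    have "norm (B p) \<le> (\<Sum>k\<in>M. norm p * norm (B (Poly_Mapping.single k 1)))"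
      unfolding linear_on_supported_eq_sum[OF assms that]
      using norm_lookup_le[of p] by (intro sum_norm_le) (simp add: mult_right_mono)
    then show ?thesis
      by (simp add: C_def sum_distrib_left mult.commute)
  qed
  moreover have "0 \<le> C"
    by (simp add: C_def sum_nonneg)
  ultimately show ?thesis
    using that by blast
qed

text \<open>On the subspace \<open>B\<close> is a finite combination of coefficient functionals,
  each of which is bounded and therefore passes through a convergent series.\<close>

lemma linear_on_supported_sums:
  fixes B :: "('k \<Rightarrow>\<^sub>0 real) \<Rightarrow> 'b::real_normed_vector"
  assumes "finite M" and B: "linear_on {p. Poly_Mapping.keys p \<subseteq> M} W B"
    and f: "f sums s" "\<And>n. Poly_Mapping.keys (f n) \<subseteq> M" and s: "Poly_Mapping.keys s \<subseteq> M"
  shows "(\<lambda>n. B (f n)) sums B s"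
  unfolding linear_on_supported_eq_sum[OF assms(1) B f(2)] linear_on_supported_eq_sum[OF assms(1) B s]
  by (intro sums_sum bounded_linear.sums[OF bounded_linear_scaleR_left]
      bounded_linear.sums[OF bounded_linear_lookup] f(1))

lemma linear_on_funpow:
  assumes "linear_on V V B"
  shows "linear_on V V (B ^^ j)"
proof (induction j)
  case (Suc j)
  then show ?case
    using assms by (simp add: linear_on_def image_subset_iff)
qed (simp add: linear_on_def)

subsection \<open>The exponential of an endomorphism\<close>

text \<open>Scalar form of \<open>e^{-B} e^B = 1\<close>, meant for \<open>a n\<close> a fixed
  coefficient of \<open>(B ^^ n) p\<close>. The double series is dominated by \<open>D\<close> times
  a product of two exponential series, so it may be summed along diagonals, where the binomial
  theorem kills all but the first.\<close>

lemma exp_double_series_cancel: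
  fixes a :: "nat \<Rightarrow> real"
  assumes bound: "\<And>n. \<bar>a n\<bar> \<le> D * C ^ n" and "0 \<le> C"
  shows "(\<lambda>j. (- 1) ^ j / fact j * suminf (\<lambda>k. a (j + k) / fact k)) sums a 0"
proof -
  have D: "0 \<le> D"
    using bound[of 0] by simp
  define F where "F = (\<lambda>(j, k). (- 1) ^ j / fact j * (a (j + k) / fact k))"
  define g where "g = (\<lambda>k. C ^ k / fact k)"
  have g_nonneg: "0 \<le> g k" for k
    using \<open>0 \<le> C\<close> by (simp add: g_def)
  have g: "summable g"
    using summable_exp[of C] by (simp add: g_def divide_inverse mult.commute)
  then have g_on: "g summable_on UNIV"
    using g_nonneg by (intro norm_summable_imp_summable_on) simp
  \<comment> \<open>Summability of the product over pairs is checked by rows: row \<open>j\<close>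
    is \<open>g j\<close> times a summable series, and the row sums are again a multiple of
    \<open>g\<close>.\<close>
  have "(\<lambda>jk. norm (g (fst jk) * g (snd jk))) summable_on (UNIV \<times> UNIV)"
  proof (rule iffD2[OF Infinite_Sum.abs_summable_on_Sigma_iff], intro conjI ballI)
    have eq: "norm (g (fst (j, k)) * g (snd (j, k))) = g j * g k" for j k
      using g_nonneg by simp
    show "(\<lambda>k. norm (g (fst (j, k)) * g (snd (j, k)))) summable_on UNIV" for j
      unfolding eq by (rule summable_on_cmult_right[OF g_on])
    have "norm (g j * infsum g UNIV) = g j * infsum g UNIV" for j
      using g_nonneg by (simp add: infsum_nonneg)
    then show "(\<lambda>j. norm (infsum (\<lambda>k. norm (g (fst (j, k)) * g (snd (j, k)))) UNIV)) summable_on UNIV"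
      unfolding eq infsum_cmult_right' using summable_on_cmult_left[OF g_on] by simp
  qed
  then have g2: "(\<lambda>jk. D * (g (fst jk) * g (snd jk))) summable_on (UNIV \<times> UNIV)"
    by (rule summable_on_cmult_right[OF abs_summable_summable])
  have "(\<lambda>jk. norm (F jk)) summable_on (UNIV \<times> UNIV)"
  \<comment> \<open>The bound at \<open>j + k\<close> splits as \<open>C ^ j * C ^ k\<close>, which
    makes the majorant a product.\<close>
  proof (rule Infinite_Sum.abs_summable_on_comparison_test'[OF g2])
    fix jk :: "nat \<times> nat"
    show "norm (F jk) \<le> D * (g (fst jk) * g (snd jk))"
      using bound[of "fst jk + snd jk"]
      by (simp add: F_def g_def case_prod_beta abs_mult power_add field_simps)
  qed
  then have F: "(F has_sum infsum F (UNIV \<times> UNIV)) (UNIV \<times> UNIV)"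
    by (rule has_sum_infsum[OF abs_summable_summable])
  have inner: "((\<lambda>k. F (j, k)) has_sum ((- 1) ^ j / fact j * suminf (\<lambda>k. a (j + k) / fact k))) UNIV" for j
  proof -
    have "summable (\<lambda>k. norm (a (j + k) / fact k))"
    proof (rule summable_comparison_test'[where N = 0])
      show "summable (\<lambda>k. D * C ^ j * g k)"
        using g by (rule summable_mult)
      show "norm (norm (a (j + k) / fact k)) \<le> D * C ^ j * g k" for k
        using bound[of "j + k"] by (simp add: g_def power_add field_simps)
    qed
    then have "((\<lambda>k. a (j + k) / fact k) has_sum suminf (\<lambda>k. a (j + k) / fact k)) UNIV"
      by (metis norm_summable_imp_has_sum summable_norm_cancel summable_sums)
    then show ?thesis
      unfolding F_def prod.case by (rule has_sum_cmult_right)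
  qed
  have "((\<lambda>j. (- 1) ^ j / fact j * suminf (\<lambda>k. a (j + k) / fact k)) has_sum infsum F (UNIV \<times> UNIV)) UNIV"
    by (rule has_sum_SigmaD[OF F inner])
  moreover have "infsum F (UNIV \<times> UNIV) = a 0"
  proof -
    \<comment> \<open>\<open>G\<close> lists the same terms by diagonal: \<open>n = j + k\<close>
      with \<open>j\<close> running up to \<open>n\<close>.\<close>
    define G where "G = (\<lambda>(n, j). F (j, n - j))"
    have "(G has_sum infsum F (UNIV \<times> UNIV)) (Sigma UNIV (\<lambda>n. {..n}))"
      unfolding G_def
      by (rule iffD2[OF has_sum_reindex_bij_witness[where j = "\<lambda>(n, j). (j, n - j)"
            and i = "\<lambda>(j, k). (j + k, j)"] F]) auto
    moreover have "((\<lambda>j. G (n, j)) has_sum (if n = 0 then a 0 else 0)) {..n}" for n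
    proof -
      \<comment> \<open>On a diagonal the two factorials combine to a binomial coefficient over
        \<open>fact n\<close>. The resulting power of \<open>-1 + 1\<close> vanishes except at
        \<open>n = 0\<close>, where \<open>0 ^ 0 = 1\<close> leaves \<open>a 0\<close>.\<close>
      have "(\<Sum>j\<le>n. F (j, n - j)) = a n / fact n * (\<Sum>j\<le>n. of_nat (n choose j) * (- 1) ^ j * 1 ^ (n - j))"
        unfolding sum_distrib_left F_def by (intro sum.cong) (auto simp: binomial_fact)
      also have "\<dots> = a n / fact n * ((- 1) + 1) ^ n"
        by (simp only: binomial_ring)
      finally have "(\<Sum>j\<le>n. F (j, n - j)) = (if n = 0 then a 0 else 0)"
        by auto
      then show ?thesis
        unfolding G_def by (intro has_sum_finiteI) auto
    qed
    ultimately have "((\<lambda>n::nat. if n = 0 then a 0 else 0) has_sum infsum F (UNIV \<times> UNIV)) UNIV"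
      by (rule has_sum_SigmaD)
    moreover have "((\<lambda>n::nat. if n = 0 then a 0 else 0) has_sum a 0) UNIV"
      by (rule has_sum_finite_neutralI[of "{0}"]) auto
    ultimately show ?thesis
      by (rule has_sum_unique)
  qed
  ultimately show ?thesis
    by (simp add: has_sum_imp_sums)
qed

lemma norm_funpow_le:
  fixes B :: "'a::real_normed_vector \<Rightarrow> 'a"
  assumes "B ` V \<subseteq> V" "0 \<le> C" "\<And>p. p \<in> V \<Longrightarrow> norm (B p) \<le> C * norm p" "p \<in> V"
  shows "norm ((B ^^ k) p) \<le> norm p * C ^ k"
proof -
  have "(B ^^ k) p \<in> V \<and> norm ((B ^^ k) p) \<le> norm p * C ^ k"
  proof (induction k)
    case (Suc k)
    then have "norm (B ((B ^^ k) p)) \<le> C * (norm p * C ^ k)"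
      using assms(2,3) by (meson mult_left_mono order_trans)
    then show ?case
      using Suc assms(1) by (auto simp: mult_ac)
  qed (simp add: assms)
  then show ?thesis ..
qed

context
  fixes M :: "'k set" and B :: "('k \<Rightarrow>\<^sub>0 real) \<Rightarrow> ('k \<Rightarrow>\<^sub>0 real)"
  assumes M: "finite M"
    and B: "linear_on {p. Poly_Mapping.keys p \<subseteq> M} {p. Poly_Mapping.keys p \<subseteq> M} B"
begin

lemma keys_funpow_subset:
  assumes "Poly_Mapping.keys p \<subseteq> M"
  shows "Poly_Mapping.keys ((B ^^ k) p) \<subseteq> M"
  using linear_on_funpow[OF B, of k] assms unfolding linear_on_def by blast

lemma lookup_funpow_bounded:
  obtains C where "0 \<le> C" "\<And>p k i. Poly_Mapping.keys p \<subseteq> M \<Longrightarrow>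
    \<bar>Poly_Mapping.lookup ((B ^^ k) p) i\<bar> \<le> norm p * C ^ k"
proof -
  obtain C where C: "0 \<le> C" "\<And>p. Poly_Mapping.keys p \<subseteq> M \<Longrightarrow> norm (B p) \<le> C * norm p"
    using linear_on_supported_bounded[OF M B] by blast
  have "\<bar>Poly_Mapping.lookup ((B ^^ k) p) i\<bar> \<le> norm p * C ^ k"
    if "Poly_Mapping.keys p \<subseteq> M" for p k i
  proof -
    have "norm ((B ^^ k) p) \<le> norm p * C ^ k"
      using B C that by (intro norm_funpow_le[where V = "{p. Poly_Mapping.keys p \<subseteq> M}"])
        (auto simp: linear_on_def)
    then show ?thesis
      using norm_lookup_le[of "(B ^^ k) p" i] by simp
  qed
  then show ?thesis
    using that C(1) by blast
qed

text \<open>Each coefficient series converges by comparison with a scalar exponential. Recombining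
  the finitely many limits produces an explicit sum \<open>s\<close> inside the subspace, so
  completeness is never invoked.\<close>

lemma op_exp_supported_sums:
  assumes p: "Poly_Mapping.keys p \<subseteq> M"
  shows "(\<lambda>k. (1 / fact k) *\<^sub>R (B ^^ k) p) sums op_exp B p"
    and "Poly_Mapping.keys (op_exp B p) \<subseteq> M"
proof -
  obtain C where C: "0 \<le> C"
    "\<And>k i. \<bar>Poly_Mapping.lookup ((B ^^ k) p) i\<bar> \<le> norm p * C ^ k"
    using lookup_funpow_bounded p by metis
  have coord: "summable (\<lambda>k. Poly_Mapping.lookup ((B ^^ k) p) i / fact k)" for i
  proof (rule summable_comparison_test'[where N = 0])
    show "summable (\<lambda>k. norm p * (C ^ k / fact k))"
      using summable_exp[of C] by (intro summable_mult) (simp add: divide_inverse mult.commute)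
    show "norm (Poly_Mapping.lookup ((B ^^ k) p) i / fact k) \<le> norm p * (C ^ k / fact k)" for k
      using C(2)[of k i] by (simp add: field_simps)
  qed
  define s where "s = (\<Sum>i\<in>M. suminf (\<lambda>k. Poly_Mapping.lookup ((B ^^ k) p) i / fact k)
      *\<^sub>R Poly_Mapping.single i (1::real))"
  have "(\<lambda>k. \<Sum>i\<in>M. (Poly_Mapping.lookup ((B ^^ k) p) i / fact k)
      *\<^sub>R Poly_Mapping.single i (1::real)) sums s"
    unfolding s_def
    by (intro sums_sum bounded_linear.sums[OF bounded_linear_scaleR_left] summable_sums coord)
  moreover have "(\<Sum>i\<in>M. (Poly_Mapping.lookup ((B ^^ k) p) i / fact k) *\<^sub>R Poly_Mapping.single i (1::real))
      = (1 / fact k) *\<^sub>R (B ^^ k) p" for k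
    using arg_cong[OF poly_mapping_eq_sum_single[OF M keys_funpow_subset[OF p, of k]],
        of "\<lambda>q. (1 / fact k) *\<^sub>R q"]
    by (simp add: scaleR_sum_right scaleR_single_one scaleR_single)
  ultimately have s: "(\<lambda>k. (1 / fact k) *\<^sub>R (B ^^ k) p) sums s"
    by simp
  then have "op_exp B p = s"
    by (simp add: op_exp_def sums_iff)
  moreover have "Poly_Mapping.keys s \<subseteq> M"
    unfolding s_def scaleR_single_one by (rule keys_sum_single_subset[OF M])
  ultimately show "(\<lambda>k. (1 / fact k) *\<^sub>R (B ^^ k) p) sums op_exp B p"
    and "Poly_Mapping.keys (op_exp B p) \<subseteq> M"
    using s by simp_all
qed

end

text \<open>For each exponent \<open>i\<close> the coefficients of the iterates of \<open>B\<close>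
  on \<open>p\<close> satisfy a geometric bound, and the outer series, with its inner sums expanded,
  is the scalar double series above.\<close>

lemma op_exp_uminus_cancel:
  fixes B :: "('k \<Rightarrow>\<^sub>0 real) \<Rightarrow> ('k \<Rightarrow>\<^sub>0 real)"
  assumes M: "finite M"
    and B: "linear_on {p. Poly_Mapping.keys p \<subseteq> M} {p. Poly_Mapping.keys p \<subseteq> M} B"
    and p: "Poly_Mapping.keys p \<subseteq> M"
  shows "op_exp (\<lambda>q. - B q) (op_exp B p) = p"
proof -
  let ?V = "{p. Poly_Mapping.keys p \<subseteq> M}"
  define e where "e = op_exp B p"
  have e: "(\<lambda>k. (1 / fact k) *\<^sub>R (B ^^ k) p) sums e" "Poly_Mapping.keys e \<subseteq> M"
    using op_exp_supported_sums[OF M B p] by (auto simp: e_def)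
  have scale: "B (c *\<^sub>R q) = c *\<^sub>R B q" if "Poly_Mapping.keys q \<subseteq> M" for c q
    using B that by (simp add: linear_on_def)
  have neg: "linear_on ?V ?V (\<lambda>q. - B q)"
    using B by (auto simp: linear_on_def image_subset_iff)
  have neg_funpow: "((\<lambda>q. - B q) ^^ j) e = (- 1) ^ j *\<^sub>R (B ^^ j) e" for j
    using scale[OF keys_funpow_subset[OF M B e(2)]] by (induction j) auto
  \<comment> \<open>Moving \<open>B ^^ j\<close> inside the series for \<open>e\<close> turns
    \<open>(B ^^ j) e\<close> into the inner sum over \<open>k\<close>.\<close>
  have funpow_e: "(\<lambda>k. (1 / fact k) *\<^sub>R (B ^^ (j + k)) p) sums (B ^^ j) e" for j
  proof -
    have "(B ^^ j) ((1 / fact k) *\<^sub>R (B ^^ k) p) = (1 / fact k) *\<^sub>R (B ^^ (j + k)) p" for k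
      using linear_on_funpow[OF B, of j] keys_funpow_subset[OF M B p, of k]
      by (simp add: linear_on_def funpow_add)
    moreover have "(\<lambda>k. (B ^^ j) ((1 / fact k) *\<^sub>R (B ^^ k) p)) sums (B ^^ j) e"
      using e by (intro linear_on_supported_sums[OF M linear_on_funpow[OF B]]
          order_trans[OF keys_scaleR_subset keys_funpow_subset[OF M B p]])
    ultimately show ?thesis
      by simp
  qed
  obtain C where C: "0 \<le> C"
    "\<And>k i. \<bar>Poly_Mapping.lookup ((B ^^ k) p) i\<bar> \<le> norm p * C ^ k"
    using lookup_funpow_bounded[OF M B] p by metis
  show ?thesis
  proof (rule poly_mapping_eqI)
    fix i
    define a where "a = (\<lambda>k. Poly_Mapping.lookup ((B ^^ k) p) i)"
    have "(\<lambda>j. (- 1) ^ j / fact j * suminf (\<lambda>k. a (j + k) / fact k)) sums a 0"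
      using C by (intro exp_double_series_cancel[where D = "norm p" and C = C]) (auto simp: a_def)
    moreover have "suminf (\<lambda>k. a (j + k) / fact k) = Poly_Mapping.lookup ((B ^^ j) e) i" for j
      using bounded_linear.sums[OF bounded_linear_lookup[of i] funpow_e[of j]]
      by (simp add: a_def sums_iff)
    ultimately have "(\<lambda>j. (- 1) ^ j / fact j * Poly_Mapping.lookup ((B ^^ j) e) i) sums
        Poly_Mapping.lookup p i"
      by (simp add: a_def)
    moreover have "(\<lambda>j. (- 1) ^ j / fact j * Poly_Mapping.lookup ((B ^^ j) e) i) sums
        Poly_Mapping.lookup (op_exp (\<lambda>q. - B q) e) i"
      using bounded_linear.sums[OF bounded_linear_lookup op_exp_supported_sums(1)[OF M neg e(2)], of i]
      by (simp add: neg_funpow field_simps)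
    ultimately show "Poly_Mapping.lookup (op_exp (\<lambda>q. - B q) (op_exp B p)) i = Poly_Mapping.lookup p i"
      by (simp add: sums_iff e_def)
  qed
qed

subsection \<open>Evaluation and degree of polynomials\<close>

abbreviation monom_eval :: "('n::finite \<Rightarrow>\<^sub>0 nat) \<Rightarrow> real ^ 'n \<Rightarrow> real" where
  "monom_eval a x \<equiv> (\<Prod>i\<in>UNIV. (x $ i) ^ Poly_Mapping.lookup a i)"

lemma poly_eval_eq_sum:
  assumes "finite M" "Poly_Mapping.keys p \<subseteq> M"
  shows "poly_eval p x = (\<Sum>a\<in>M. Poly_Mapping.lookup p a * monom_eval a x)"
  unfolding poly_eval_def using assms by (intro sum.mono_neutral_left) (auto simp: in_keys_iff)

lemma poly_eval_zero [simp]: "poly_eval 0 x = 0"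
  by (simp add: poly_eval_def)

lemma poly_eval_single [simp]: "poly_eval (Poly_Mapping.single a c) x = c * monom_eval a x"
  by (simp add: poly_eval_def)

lemma poly_eval_add [simp]: "poly_eval (p + q) x = poly_eval p x + poly_eval q x"
proof -
  let ?M = "Poly_Mapping.keys p \<union> Poly_Mapping.keys q"
  have "poly_eval r x = (\<Sum>a\<in>?M. Poly_Mapping.lookup r a * monom_eval a x)"
    if "r \<in> {p, q, p + q}" for r
    using that Poly_Mapping.keys_add[of p q] by (intro poly_eval_eq_sum) auto
  then show ?thesis
    by (simp add: lookup_add distrib_right sum.distrib)
qed

lemma poly_eval_sum [simp]: "poly_eval (\<Sum>k\<in>M. f k) x = (\<Sum>k\<in>M. poly_eval (f k) x)"
  by (induction M rule: infinite_finite_induct) auto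

lemma poly_eval_scaleR [simp]: "poly_eval (c *\<^sub>R p) x = c * poly_eval p x"
  using poly_eval_eq_sum[OF finite_keys keys_scaleR_subset, of c p x]
  by (simp add: poly_eval_def sum_distrib_left mult.assoc)

lemma monom_eval_add: "monom_eval (a + b) x = monom_eval a x * monom_eval b x"
  by (simp add: lookup_add power_add prod.distrib)

lemma poly_eval_mult [simp]: "poly_eval (p * q) x = poly_eval p x * poly_eval q x"
proof -
  have "p * q = (\<Sum>a\<in>Poly_Mapping.keys p. Poly_Mapping.single a (Poly_Mapping.lookup p a)) *
      (\<Sum>b\<in>Poly_Mapping.keys q. Poly_Mapping.single b (Poly_Mapping.lookup q b))"
    using poly_mapping_eq_sum_single[OF finite_keys order_refl] by metis
  then have "poly_eval (p * q) x =
      (\<Sum>a\<in>Poly_Mapping.keys p. \<Sum>b\<in>Poly_Mapping.keys q.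
        (Poly_Mapping.lookup p a * monom_eval a x) * (Poly_Mapping.lookup q b * monom_eval b x))"
    by (simp add: sum_product mult_single monom_eval_add mult_ac del: scaleR_single)
  then show ?thesis
    by (simp add: poly_eval_def sum_product)
qed

lemma poly_eval_one [simp]: "poly_eval 1 x = 1"
  by (simp add: poly_eval_def)

lemma poly_eval_power [simp]: "poly_eval (p ^ k) x = poly_eval p x ^ k"
  by (induction k) simp_all

lemma continuous_on_poly_eval: "continuous_on S (poly_eval p)"
  unfolding poly_eval_def by (intro continuous_intros)

lemma monom_degree_add [simp]: "monom_degree (a + b) = monom_degree a + monom_degree b"
  by (simp add: monom_degree_def lookup_add sum.distrib)

lemma monom_degree_zero [simp]: "monom_degree 0 = 0"
  by (simp add: monom_degree_def)

section \<open>Monomials and polynomials of bounded degree\<close>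

lemma finite_monom_degree_le: "finite {a :: 'n::finite \<Rightarrow>\<^sub>0 nat. monom_degree a \<le> m}"
proof (rule inj_on_finite)
  show "inj_on Poly_Mapping.lookup {a :: 'n \<Rightarrow>\<^sub>0 nat. monom_degree a \<le> m}"
    by (auto simp: inj_on_def lookup_inject)
  have "Poly_Mapping.lookup a i \<le> monom_degree a" for a :: "'n \<Rightarrow>\<^sub>0 nat" and i
    unfolding monom_degree_def by (rule member_le_sum) auto
  then show "Poly_Mapping.lookup ` {a :: 'n \<Rightarrow>\<^sub>0 nat. monom_degree a \<le> m} \<subseteq> PiE UNIV (\<lambda>_. {..m})"
    by (auto intro: order_trans)
  show "finite (PiE (UNIV :: 'n set) (\<lambda>_. {..m}))"
    by (intro finite_PiE) auto
qed

lemma polys_le_eq: "polys_le m = {p. Poly_Mapping.keys p \<subseteq> {a. monom_degree a \<le> m}}"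
  by (auto simp: polys_le_def)

lemma polys_le_zero [simp]: "0 \<in> polys_le m"
  by (simp add: polys_le_def)

lemma polys_le_single: "monom_degree a \<le> m \<Longrightarrow> Poly_Mapping.single a c \<in> polys_le m"
  by (simp add: polys_le_def)

lemma polys_le_add: "p \<in> polys_le m \<Longrightarrow> q \<in> polys_le m \<Longrightarrow> p + q \<in> polys_le m"
  using Poly_Mapping.keys_add[of p q] by (auto simp: polys_le_def)

lemma polys_le_scaleR: "p \<in> polys_le m \<Longrightarrow> c *\<^sub>R p \<in> polys_le m"
  using keys_scaleR_subset[of c p] by (auto simp: polys_le_def)

lemma polys_le_mult:
  assumes "p \<in> polys_le m" "q \<in> polys_le n"
  shows "p * q \<in> polys_le (m + n)"
  using keys_mult[of p q] assms by (fastforce simp: polys_le_def)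

text \<open>Degree is moved from \<open>b\<close> to \<open>a\<close> one unit at a time, which is
  possible as long as \<open>b\<close> still has a nonzero exponent.\<close>

lemma monom_split:
  assumes "k \<le> monom_degree c"
  shows "\<exists>a b. c = a + b \<and> monom_degree a = k"
  using assms
proof (induction k)
  case 0
  show ?case by (intro exI[of _ 0] exI[of _ c]) simp
next
  case (Suc k)
  then obtain a b where ab: "c = a + b" "monom_degree a = k"
    by auto
  with Suc.prems have "monom_degree b \<noteq> 0" by simp
  then obtain i where i: "Poly_Mapping.lookup b i \<noteq> 0"
    by (auto simp: monom_degree_def)
  let ?e = "Poly_Mapping.single i (1::nat)"
  \<comment> \<open>Subtraction of exponents is truncated at zero; the positive exponent at
    \<open>i\<close> makes it exact here.\<close>
  have "b = ?e + (b - ?e)"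
    using i by (intro poly_mapping_eqI) (auto simp: lookup_add lookup_minus lookup_single when_def)
  then have "c = (a + ?e) + (b - ?e)"
    using ab(1) by (simp add: add.assoc)
  moreover have "monom_degree (a + ?e) = Suc k"
    by (simp add: ab(2)) (simp add: monom_degree_def lookup_single when_def)
  ultimately show ?case by blast
qed

section \<open>Polynomials vanishing on a large set have zero coefficients\<close>

lemma univariate_eq_0:
  fixes c :: "nat \<Rightarrow> real"
  assumes "finite N" "infinite X" "\<And>t. t \<in> X \<Longrightarrow> (\<Sum>k\<in>N. c k * t ^ k) = 0" "k \<in> N"
  shows "c k = 0"
proof (rule ccontr)
  assume ck: "c k \<noteq> 0"
  \<comment> \<open>The root bound speaks about sums over an initial segment of exponents, so the
    coefficients are padded by zero.\<close>
  define c' where "c' = (\<lambda>k. if k \<in> N then c k else 0)"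
  have le: "j \<le> Max N" if "j \<in> N" for j
    using assms(1) that by simp
  have "(\<Sum>j\<le>Max N. c' j * t ^ j) = (\<Sum>j\<in>N. c j * t ^ j)" for t
    using le assms(1) by (intro sum.mono_neutral_cong_right) (auto simp: c'_def)
  then have "X \<subseteq> {t. (\<Sum>j\<le>Max N. c' j * t ^ j) = 0}"
    using assms(3) by auto
  moreover have "c' k \<noteq> 0"
    using ck assms(4) by (simp add: c'_def)
  then have "finite {t. (\<Sum>j\<le>Max N. c' j * t ^ j) = 0}"
    using polyfun_rootbound[of "Max N" c'] le[OF assms(4)] by blast
  ultimately show False
    using assms(2) finite_subset by blast
qed

text \<open>Induction on the variables. With all but \<open>x j\<close> fixed, grouping by powers of
  \<open>x j\<close> gives a univariate polynomial with infinitely many roots, so every group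
  vanishes as an expression in the remaining variables. The injectivity assumption says that
  distinct indices are distinct monomials in the variables of \<open>I\<close>.\<close>

lemma monomials_independent_on_grid:
  fixes c :: "'b \<Rightarrow> real" and e :: "'b \<Rightarrow> 'n \<Rightarrow> nat"
  assumes "finite I" "finite A" "\<And>i. i \<in> I \<Longrightarrow> infinite (X i)"
    and "inj_on (\<lambda>a. restrict (e a) I) A"
    and "\<And>x. (\<And>i. i \<in> I \<Longrightarrow> x i \<in> X i) \<Longrightarrow> (\<Sum>a\<in>A. c a * (\<Prod>i\<in>I. x i ^ e a i)) = 0"
    and "a \<in> A"
  shows "c a = 0"
  using assms
proof (induction I arbitrary: A a rule: finite_induct)
  case empty
  \<comment> \<open>With no variables left, all restricted exponents coincide, so injectivity leaves
    a single index and the vanishing sum is \<open>c a\<close> itself.\<close>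
  then have "A = {a}"
    by (auto simp: inj_on_def restrict_def)
  then show ?case
    using empty.prems(4) by simp
next
  case (insert j I)
  let ?A = "\<lambda>k. {b \<in> A. e b j = k}"
  have sections: "(\<Sum>b\<in>?A k. c b * (\<Prod>i\<in>I. x i ^ e b i)) = 0"
    if x: "\<And>i. i \<in> I \<Longrightarrow> x i \<in> X i" and k: "k \<in> (\<lambda>b. e b j) ` A" for x k
  proof (rule univariate_eq_0[OF _ _ _ k, where X = "X j"])
    show "finite ((\<lambda>b. e b j) ` A)" "infinite (X j)"
      using insert.prems by auto
    fix t assume t: "t \<in> X j"
    let ?x = "x(j := t)"
    have prod: "(\<Prod>i\<in>insert j I. ?x i ^ e b i) = (\<Prod>i\<in>I. x i ^ e b i) * t ^ e b j" for b
    proof -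
      have "(\<Prod>i\<in>I. ?x i ^ e b i) = (\<Prod>i\<in>I. x i ^ e b i)"
        using insert.hyps by (intro prod.cong) auto
      then show ?thesis
        using insert.hyps by simp
    qed
    have "(\<Sum>k\<in>(\<lambda>b. e b j) ` A. (\<Sum>b\<in>?A k. c b * (\<Prod>i\<in>I. x i ^ e b i)) * t ^ k)
        = (\<Sum>k\<in>(\<lambda>b. e b j) ` A. \<Sum>b\<in>?A k. c b * (\<Prod>i\<in>insert j I. ?x i ^ e b i))"
      unfolding prod by (simp add: sum_distrib_right mult.assoc)
    also have "\<dots> = (\<Sum>b\<in>A. c b * (\<Prod>i\<in>insert j I. ?x i ^ e b i))"
      using insert.prems(1) by (intro sum.group) auto
    also have "\<dots> = 0"
      using x t by (intro insert.prems(4)) auto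
    finally show "(\<Sum>k\<in>(\<lambda>b. e b j) ` A. (\<Sum>b\<in>?A k. c b * (\<Prod>i\<in>I. x i ^ e b i)) * t ^ k) = 0" .
  qed
  show ?case
  \<comment> \<open>Indices in one group share the exponent at \<open>j\<close>, so the variables in
    \<open>I\<close> alone must distinguish them.\<close>
  proof (rule insert.IH[where A = "?A (e a j)"])
    show "inj_on (\<lambda>b. restrict (e b) I) (?A (e a j))"
    proof (rule inj_onI)
      fix b b' assume b: "b \<in> ?A (e a j)" "b' \<in> ?A (e a j)" "restrict (e b) I = restrict (e b') I"
      have "e b i = e b' i" if "i \<in> I" for i
        using fun_cong[OF b(3), of i] that by simp
      then have "restrict (e b) (insert j I) = restrict (e b') (insert j I)"
        using b(1,2) by (auto simp: restrict_def)
      then show "b = b'"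
        using b(1,2) by (intro inj_onD[OF insert.prems(3)]) auto
    qed
  qed (use insert.prems sections in auto)
qed

text \<open>An open set contains an open box around any of its points, and such a box is a grid of
  infinite intervals.\<close>

lemma poly_eval_eq_0_on_open:
  assumes U: "open U" "U \<noteq> {}" and zero: "\<And>x. x \<in> U \<Longrightarrow> poly_eval p x = 0"
  shows "p = 0"
proof (rule ccontr)
  assume "p \<noteq> 0"
  then obtain a where a: "a \<in> Poly_Mapping.keys p"
    by (metis ex_in_conv keys_eq_empty)
  obtain x0 where "x0 \<in> U" using U by blast
  then obtain l u where lu: "x0 \<in> box l u" "box l u \<subseteq> U"
    using open_contains_box[OF U(1)] by (metis interior_subset mem_box(1) subset_iff)
  have "Poly_Mapping.lookup p a = 0"
  proof (rule monomials_independent_on_grid[OF finite finite_keys _ _ _ a])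
    show "infinite {l $ i <..< u $ i}" for i
    proof -
      have "l $ i < u $ i"
        using lu(1) by (metis less_trans mem_box_cart(1))
      then show ?thesis
        by (rule infinite_Ioo)
    qed
    show "inj_on (\<lambda>a. restrict (Poly_Mapping.lookup a) UNIV) (Poly_Mapping.keys p)"
      by (intro inj_onI poly_mapping_eqI) (metis UNIV_I restrict_apply')
    fix x :: "'a \<Rightarrow> real"
    assume "\<And>i. i \<in> UNIV \<Longrightarrow> x i \<in> {l $ i <..< u $ i}"
    then have "(\<chi> i. x i) \<in> U"
      using lu(2) by (auto simp: mem_box_cart subset_iff)
    from zero[OF this]
    show "(\<Sum>a\<in>Poly_Mapping.keys p. Poly_Mapping.lookup p a * (\<Prod>i\<in>UNIV. x i ^ Poly_Mapping.lookup a i)) = 0"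
      by (simp add: poly_eval_def)
  qed
  with a show False
    by (simp add: in_keys_iff)
qed

subsection \<open>The Gaussian functional\<close>

text \<open>\<open>lborel\<close> is the image of the product measure under the coordinate map, so
  integrability of a product of one-variable functions reduces to that of its factors.\<close>

lemma integrable_lborel_prod_Basis:
  fixes f :: "'a::euclidean_space \<Rightarrow> real \<Rightarrow> real"
  assumes "\<And>b. b \<in> Basis \<Longrightarrow> integrable lborel (f b)"
  shows "integrable lborel (\<lambda>x::'a. \<Prod>b\<in>Basis. f b (x \<bullet> b))"
proof -
  interpret product_sigma_finite "\<lambda>_::'a. lborel :: real measure"
    by standard
  have [measurable]: "f b \<in> borel_measurable borel" if "b \<in> Basis" for b
    using borel_measurable_integrable[OF assms[OF that]] by simp
  have "integrable (Pi\<^sub>M Basis (\<lambda>_. lborel)) (\<lambda>x. \<Prod>b\<in>Basis. f b (x b))"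
    by (intro product_integrable_prod assms) auto
  then have "integrable (Pi\<^sub>M Basis (\<lambda>_. lborel))
      (\<lambda>x. \<Prod>b\<in>Basis. f b ((\<Sum>c\<in>Basis. x c *\<^sub>R c) \<bullet> b))"
    by simp
  then show ?thesis
    unfolding lborel_eq[where 'a = 'a] by (subst integrable_distr_eq) auto
qed

lemma integrable_lborel_prod_cart:
  fixes h :: "'n::finite \<Rightarrow> real \<Rightarrow> real"
  assumes "\<And>i. integrable lborel (h i)"
  shows "integrable lborel (\<lambda>x::real^'n. \<Prod>i\<in>UNIV. h i (x $ i))"
proof -
  \<comment> \<open>The factors must be indexed by basis vectors; the choice recovers the unique
    \<open>i\<close> with \<open>b = axis i 1\<close>.\<close>
  define f where "f = (\<lambda>b::real^'n. h (SOME i. b = axis i 1))"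
  have f: "f (axis i 1) = h i" for i
    by (simp add: f_def axis_eq_axis)
  have Basis: "(Basis :: (real^'n) set) = (\<lambda>i. axis i 1) ` UNIV"
    by (auto simp: Basis_vec_def)
  have "integrable lborel (\<lambda>x::real^'n. \<Prod>b\<in>Basis. f b (x \<bullet> b))"
    using assms by (intro integrable_lborel_prod_Basis) (auto simp: Basis f)
  also have "(\<lambda>x::real^'n. \<Prod>b\<in>Basis. f b (x \<bullet> b)) = (\<lambda>x. \<Prod>i\<in>UNIV. h i (x $ i))"
    unfolding Basis by (subst prod.reindex) (auto simp: inj_on_def axis_eq_axis f inner_axis)
  finally show ?thesis .
qed

text \<open>The integrand is a moment integrand of the normal law with mean 0 and variance 1/2,
  rescaled by \<open>sqrt pi\<close> to remove the normalising factor.\<close>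

lemma integrable_power_gauss: "integrable lborel (\<lambda>t::real. t ^ k * exp (- t\<^sup>2))"
proof -
  have "integrable lborel (\<lambda>t. sqrt pi * (normal_density 0 (1 / sqrt 2) t * (t - 0) ^ k))"
    by (intro integrable_mult_right integrable_normal_moment) simp
  also have "(\<lambda>t. sqrt pi * (normal_density 0 (1 / sqrt 2) t * (t - 0) ^ k)) = (\<lambda>t. t ^ k * exp (- t\<^sup>2))"
    by (simp add: normal_density_def power_divide mult.commute)
  finally show ?thesis .
qed

lemma integrable_poly_gauss:
  "integrable lborel (\<lambda>x. poly_eval p x * exp (- (\<Sum>i\<in>UNIV. (x $ i)\<^sup>2)))"
proof -
  have "integrable lborel (\<lambda>x. monom_eval a x * exp (- (\<Sum>i\<in>UNIV. (x $ i)\<^sup>2)))" for a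
    using integrable_lborel_prod_cart[OF integrable_power_gauss, of "Poly_Mapping.lookup a"]
    by (simp add: prod.distrib exp_sum flip: sum_negf)
  then show ?thesis
    unfolding poly_eval_def sum_distrib_right mult.assoc
    by (intro Bochner_Integration.integrable_sum integrable_mult_right)
qed

lemma set_integrable_poly_gauss:
  assumes "closed K"
  shows "set_integrable lborel K (\<lambda>x. poly_eval p x * exp (- (\<Sum>i\<in>UNIV. (x $ i)\<^sup>2)))"
  unfolding set_integrable_def using assms integrable_poly_gauss[of p]
  by (intro integrable_mult_indicator) auto

section \<open>Linearity, strict positivity and coercivity of the functional\<close>

lemma gauss_functional_add:
  assumes "closed K"
  shows "gauss_functional K (p + q) = gauss_functional K p + gauss_functional K q"
  using set_integral_add(2)[OF assms[THEN set_integrable_poly_gauss] assms[THEN set_integrable_poly_gauss], of p q]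
  by (simp add: gauss_functional_def distrib_right)

lemma gauss_functional_scaleR: "gauss_functional K (c *\<^sub>R p) = c * gauss_functional K p"
  by (simp add: gauss_functional_def mult.assoc set_integral_mult_right)

lemma gauss_functional_nonneg:
  assumes "\<And>x. x \<in> K \<Longrightarrow> 0 \<le> poly_eval p x"
  shows "0 \<le> gauss_functional K p"
  unfolding gauss_functional_def set_lebesgue_integral_def
  by (rule integral_nonneg_AE) (auto simp: assms indicator_def)

text \<open>A zero integral would make the nonnegative integrand vanish almost everywhere on
  \<open>K\<close>; closedness of the zero set upgrades this to all of the nonempty interior, which
  forces \<open>p = 0\<close>.\<close>

lemma gauss_functional_pos:
  assumes K: "closed K" "interior K \<noteq> {}"
    and nonneg: "\<And>x. x \<in> K \<Longrightarrow> 0 \<le> poly_eval p x" and "p \<noteq> 0"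
  shows "0 < gauss_functional K p"
proof (rule ccontr)
  assume "\<not> 0 < gauss_functional K p"
  then have zero: "gauss_functional K p = 0"
    using gauss_functional_nonneg[of K p] nonneg by auto
  let ?g = "\<lambda>x. indicat_real K x *\<^sub>R (poly_eval p x * exp (- (\<Sum>i\<in>UNIV. (x $ i)\<^sup>2)))"
  have "integrable lborel ?g"
    using set_integrable_poly_gauss[OF K(1), of p] by (simp add: set_integrable_def)
  moreover have "AE x in lborel. 0 \<le> ?g x"
    using nonneg by (auto simp: indicator_def)
  ultimately have "AE x in lborel. ?g x = 0"
    using zero integral_nonneg_eq_0_iff_AE[of lborel ?g]
    by (simp add: gauss_functional_def set_lebesgue_integral_def)
  then have "AE x in lborel. x \<in> interior K \<longrightarrow> x \<in> {x. poly_eval p x = 0}"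
  proof eventually_elim
    case (elim x)
    then show ?case
      using interior_subset[of K] by (auto simp: indicator_def split: if_splits)
  qed
  \<comment> \<open>Passing to the completion makes available that a closed set containing almost
    every point of an open set contains all of it.\<close>
  then have "AE x \<in> interior K in lebesgue. x \<in> {x. poly_eval p x = 0}"
    by (rule AE_completion)
  moreover have "closed {x. poly_eval p x = 0}"
    by (intro closed_Collect_eq continuous_on_poly_eval continuous_on_const)
  ultimately have "poly_eval p x = 0" if "x \<in> interior K" for x
    using mem_closed_if_AE_lebesgue_open[OF open_interior, where x = x] that by blast
  then show False
    using poly_eval_eq_0_on_open[OF open_interior K(2)] \<open>p \<noteq> 0\<close> by blast
qed

text \<open>The functional attains a positive minimum on the norm-one elements of the cone, and
  homogeneity carries the bound to the whole cone.\<close>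

lemma Pos_le_norm_le_gauss_functional:
  fixes K :: "(real ^ 'n::finite) set"
  assumes K: "closed K" "interior K \<noteq> {}"
  obtains C where "0 < C" "\<And>p. p \<in> Pos_le K m \<Longrightarrow> norm p \<le> C * gauss_functional K p"
proof -
  let ?l = "gauss_functional K"
  let ?M = "{a :: 'n \<Rightarrow>\<^sub>0 nat. monom_degree a \<le> m}"
  have lin: "linear_on {p. Poly_Mapping.keys p \<subseteq> ?M} UNIV ?l"
    by (simp add: linear_on_def gauss_functional_add[OF K(1)] gauss_functional_scaleR)
  define T where "T = {p \<in> Pos_le K m. norm p = 1}"
  have evalx: "poly_eval p x = (\<Sum>a\<in>?M. Poly_Mapping.lookup p a * monom_eval a x)"
    if "p \<in> {p. Poly_Mapping.keys p \<subseteq> ?M \<and> norm p = 1}" for p x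
    using that by (intro poly_eval_eq_sum finite_monom_degree_le) auto
  \<comment> \<open>For each point of \<open>K\<close>, nonnegativity there is a closed condition on
    finitely many coefficients, so \<open>T\<close> is closed in the compact sphere.\<close>
  have "T = {p. Poly_Mapping.keys p \<subseteq> ?M \<and> norm p = 1} \<inter>
      (\<Inter>x\<in>K. {p. 0 \<le> (\<Sum>a\<in>?M. Poly_Mapping.lookup p a * monom_eval a x)})"
    using evalx by (auto simp: T_def Pos_le_def polys_le_eq)
  also have "compact \<dots>"
    by (intro compact_Int_closed compact_unit_sphere_supported finite_monom_degree_le closed_INT ballI
        closed_Collect_le continuous_intros bounded_linear.continuous_on[OF bounded_linear_lookup])
  finally have "compact T" .
  \<comment> \<open>No limit under the integral is taken: linearity writes \<open>?l\<close> as a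
    finite combination of coefficients.\<close>
  have cont: "continuous_on T ?l"
  proof -
    have "continuous_on T (\<lambda>p. \<Sum>a\<in>?M. Poly_Mapping.lookup p a *\<^sub>R ?l (Poly_Mapping.single a 1))"
      by (intro continuous_intros bounded_linear.continuous_on[OF bounded_linear_lookup])
    moreover have "(\<Sum>a\<in>?M. Poly_Mapping.lookup p a *\<^sub>R ?l (Poly_Mapping.single a 1)) = ?l p" if "p \<in> T" for p
      using that linear_on_supported_eq_sum[OF finite_monom_degree_le lin, of p]
      by (simp add: T_def Pos_le_def polys_le_eq)
    ultimately show ?thesis
      by (rule continuous_on_eq)
  qed
  have pos: "0 < ?l p" if "p \<in> T" for p
    using that by (intro gauss_functional_pos[OF K]) (auto simp: T_def Pos_le_def)
  obtain c where c: "0 < c" "\<And>p. p \<in> T \<Longrightarrow> c \<le> ?l p"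
  proof (cases "T = {}")
    case True
    then show ?thesis using that[of 1] by simp
  next
    case False
    then show ?thesis
      using continuous_attains_inf[OF \<open>compact T\<close> False cont] pos that by metis
  qed
  have "norm p \<le> inverse c * ?l p" if p: "p \<in> Pos_le K m" for p
  proof (cases "p = 0")
    case True
    then show ?thesis
      using gauss_functional_scaleR[of K 0 0] by simp
  next
    case False
    then have "p /\<^sub>R norm p \<in> T"
      using p polys_le_scaleR by (auto simp: T_def Pos_le_def)
    then have "c \<le> ?l p / norm p"
      using c(2) by (fastforce simp: gauss_functional_scaleR divide_inverse mult.commute)
    then show ?thesis
      using False c(1) by (simp add: field_simps)
  qed
  then show ?thesis
    using that[of "inverse c"] c(1) by simp
qed

subsection \<open>The interior of the cone of sums of squares\<close>

lemma sos_zero: "0 \<in> sos d"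
  unfolding sos_def by (intro CollectI exI[of _ "[]"]) simp

lemma sos_square: "q \<in> polys_le d \<Longrightarrow> q\<^sup>2 \<in> sos d"
  unfolding sos_def by (intro CollectI exI[of _ "[q]"]) simp

lemma sos_add:
  assumes "p \<in> sos d" "q \<in> sos d"
  shows "p + q \<in> sos d"
proof -
  obtain ps qs where "p = (\<Sum>q\<leftarrow>ps. q\<^sup>2)" "set ps \<subseteq> polys_le d" "q = (\<Sum>q\<leftarrow>qs. q\<^sup>2)" "set qs \<subseteq> polys_le d"
    using assms by (auto simp: sos_def)
  then show ?thesis
    unfolding sos_def by (intro CollectI exI[of _ "ps @ qs"]) simp
qed

lemma sos_sum: "(\<And>k. k \<in> M \<Longrightarrow> f k \<in> sos d) \<Longrightarrow> (\<Sum>k\<in>M. f k) \<in> sos d"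
  by (induction M rule: infinite_finite_induct) (auto simp: sos_zero sos_add)

text \<open>Turns scaling into ring multiplication by a constant, so that a nonnegative scalar can
  be absorbed into a square through its square root.\<close>

lemma scaleR_eq_single_mult:
  fixes p :: "'n::finite rpoly"
  shows "c *\<^sub>R p = Poly_Mapping.single 0 c * p"
proof -
  have "c *\<^sub>R p = (\<Sum>a\<in>Poly_Mapping.keys p. c *\<^sub>R Poly_Mapping.single a (Poly_Mapping.lookup p a))"
    using arg_cong[OF poly_mapping_eq_sum_single[OF finite_keys order_refl, of p], of "\<lambda>q. c *\<^sub>R q"]
    by (simp add: scaleR_sum_right)
  also have "\<dots> = Poly_Mapping.single 0 c * (\<Sum>a\<in>Poly_Mapping.keys p. Poly_Mapping.single a (Poly_Mapping.lookup p a))"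
    by (simp add: sum_distrib_left scaleR_single mult_single)
  also have "\<dots> = Poly_Mapping.single 0 c * p"
    by (simp flip: poly_mapping_eq_sum_single[OF finite_keys order_refl])
  finally show ?thesis .
qed

lemma sos_scaleR:
  assumes "0 \<le> c" "p \<in> sos d"
  shows "c *\<^sub>R p \<in> sos d"
proof -
  obtain qs where qs: "p = (\<Sum>q\<leftarrow>qs. q\<^sup>2)" "set qs \<subseteq> polys_le d"
    using assms(2) by (auto simp: sos_def)
  have "c *\<^sub>R q\<^sup>2 = (sqrt c *\<^sub>R q)\<^sup>2" for q :: "'a rpoly"
    using assms(1)
    by (simp add: scaleR_eq_single_mult power2_eq_square mult_ac mult_single flip: mult.assoc)
  then have "c *\<^sub>R p = (\<Sum>q\<leftarrow>map (\<lambda>q. sqrt c *\<^sub>R q) qs. q\<^sup>2)"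
    unfolding qs(1) by (induction qs) (simp_all add: scaleR_add_right)
  moreover have "set (map (\<lambda>q. sqrt c *\<^sub>R q) qs) \<subseteq> polys_le d"
    using qs(2) polys_le_scaleR by auto
  ultimately show ?thesis
    unfolding sos_def by blast
qed

lemma poly_eval_sos_nonneg:
  assumes "p \<in> sos d"
  shows "0 \<le> poly_eval p x"
proof -
  obtain qs where "p = (\<Sum>q\<leftarrow>qs. q\<^sup>2)"
    using assms by (auto simp: sos_def)
  then show ?thesis
    by (induction qs arbitrary: p) auto
qed

text \<open>Restates interiority as stability under small perturbations \<open>g\<close> of bounded
  degree; translation by \<open>f\<close> preserves the subspace.\<close>

lemma int_sos_iff:
  "f \<in> int_sos d \<longleftrightarrow>
    f \<in> polys_le (2 * d) \<and> (\<exists>e>0. \<forall>g\<in>polys_le (2 * d). norm g < e \<longrightarrow> f + g \<in> sos d)"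
proof
  let ?V = "polys_le (2 * d)"
  assume "f \<in> int_sos d"
  then obtain T where T: "openin (top_of_set ?V) T" "f \<in> T" "T \<subseteq> sos d"
    by (auto simp: int_sos_def interior_of_def)
  then obtain e where e: "0 < e" "\<And>q. q \<in> ?V \<Longrightarrow> dist q f < e \<Longrightarrow> q \<in> T"
    unfolding openin_euclidean_subtopology_iff by blast
  have f: "f \<in> ?V"
    using T openin_imp_subset by blast
  have "f + g \<in> sos d" if "g \<in> ?V" "norm g < e" for g
    using e(2)[of "f + g"] that f T(3) by (auto simp: polys_le_add dist_norm)
  then show "f \<in> ?V \<and> (\<exists>e>0. \<forall>g\<in>?V. norm g < e \<longrightarrow> f + g \<in> sos d)"
    using f e(1) by blast
next
  let ?V = "polys_le (2 * d)"
  assume "f \<in> ?V \<and> (\<exists>e>0. \<forall>g\<in>?V. norm g < e \<longrightarrow> f + g \<in> sos d)"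
  then obtain e where f: "f \<in> ?V" and e: "0 < e" "\<And>g. g \<in> ?V \<Longrightarrow> norm g < e \<Longrightarrow> f + g \<in> sos d"
    by blast
  have "q \<in> sos d" if "q \<in> ?V" "dist f q < e" for q
  proof -
    have "q - f \<in> ?V"
      using polys_le_add[OF that(1) polys_le_scaleR[OF f, of "-1"]] by simp
    then show ?thesis
      using e(2)[of "q - f"] that(2) by (simp add: dist_norm norm_minus_commute)
  qed
  then have "?V \<inter> ball f e \<subseteq> sos d" "f \<in> ?V \<inter> ball f e"
    using f e(1) by auto
  moreover have "openin (top_of_set ?V) (?V \<inter> ball f e)"
    by (rule openin_open_Int[OF open_ball])
  ultimately show "f \<in> int_sos d"
    unfolding int_sos_def interior_of_def by blast
qed

text \<open>A monomial of degree at most \<open>2d\<close> is a product \<open>uv\<close> of monomials of degree at most \<open>d\<close>, and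
  \<open>s + t uv\<close> with \<open>s = (u\<^sup>2 + v\<^sup>2) / 2\<close> is a convex combination of \<open>(u + v)\<^sup>2 / 2\<close> and
  \<open>(u - v)\<^sup>2 / 2\<close>.\<close>

lemma monomial_dominated_by_sos:
  assumes "monom_degree c \<le> 2 * d"
  shows "\<exists>s\<in>polys_le (2 * d). \<forall>t. \<bar>t\<bar> \<le> 1 \<longrightarrow> s + Poly_Mapping.single c t \<in> sos d"
proof -
  \<comment> \<open>Giving \<open>a\<close> as much degree as \<open>d\<close> allows leaves
    \<open>b\<close> at most \<open>d\<close>, since the total is at most
    \<open>2 * d\<close>.\<close>
  obtain a b where c: "c = a + b" and a: "monom_degree a = min d (monom_degree c)"
    using monom_split[OF min.cobounded2] by blast
  then have deg: "monom_degree a \<le> d" "monom_degree b \<le> d"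
    using assms by auto
  define u where "u = Poly_Mapping.single a (1::real)"
  define v where "v = Poly_Mapping.single b (1::real)"
  have u: "u \<in> polys_le d" and v: "v \<in> polys_le d"
    using deg by (auto simp: u_def v_def polys_le_single)
  have uv: "u * v = Poly_Mapping.single c 1"
    by (simp add: u_def v_def c mult_single)
  define s where "s = (1 / 2) *\<^sub>R (u\<^sup>2 + v\<^sup>2)"
  have "s \<in> polys_le (2 * d)"
    unfolding s_def power2_eq_square mult_2
    by (intro polys_le_scaleR polys_le_add polys_le_mult u v)
  moreover have "s + Poly_Mapping.single c t \<in> sos d" if "\<bar>t\<bar> \<le> 1" for t
  proof -
    have "(1 / 2) *\<^sub>R r + t *\<^sub>R w
        = ((1 + t) / 4) *\<^sub>R (r + 2 *\<^sub>R w) + ((1 - t) / 4) *\<^sub>R (r - 2 *\<^sub>R w)" for r w :: "'a rpoly"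
      by (rule poly_mapping_eqI) (simp add: lookup_add lookup_minus field_simps)
    moreover have "(u + v)\<^sup>2 = u\<^sup>2 + v\<^sup>2 + 2 *\<^sub>R (u * v)" "(u - v)\<^sup>2 = u\<^sup>2 + v\<^sup>2 - 2 *\<^sub>R (u * v)"
      by (simp_all add: power2_eq_square scaleR_2 algebra_simps)
    ultimately have "s + Poly_Mapping.single c t
        = ((1 + t) / 4) *\<^sub>R (u + v)\<^sup>2 + ((1 - t) / 4) *\<^sub>R (u - v)\<^sup>2"
      unfolding s_def scaleR_single_one[of t, symmetric] uv[symmetric] by presburger
    moreover have "u - v \<in> polys_le d"
      using polys_le_add[OF u polys_le_scaleR[OF v, of "-1"]] by simp
    ultimately show ?thesis
      using that u v by (auto intro!: sos_add sos_scaleR sos_square polys_le_add)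
  qed
  ultimately show ?thesis
    by blast
qed

text \<open>Summing the dominating polynomials over all monomials gives an interior point: a
  perturbation of norm below 1 has coefficients of modulus at most 1, and each of its terms is
  absorbed by its own summand.\<close>

lemma int_sos_nonempty: "int_sos d \<noteq> ({} :: 'n::finite rpoly set)"
proof -
  let ?M = "{c :: 'n \<Rightarrow>\<^sub>0 nat. monom_degree c \<le> 2 * d}"
  have "\<forall>c\<in>?M. \<exists>s. s \<in> polys_le (2 * d) \<and> (\<forall>t. \<bar>t\<bar> \<le> 1 \<longrightarrow> s + Poly_Mapping.single c t \<in> sos d)"
    using monomial_dominated_by_sos by blast
  from bchoice[OF this] obtain s
    where s: "\<And>c. c \<in> ?M \<Longrightarrow> s c \<in> polys_le (2 * d)"
      "\<And>c t. c \<in> ?M \<Longrightarrow> \<bar>t\<bar> \<le> 1 \<Longrightarrow> s c + Poly_Mapping.single c t \<in> sos d"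
    by blast
  define f where "f = (\<Sum>c\<in>?M. s c)"
  have "(\<Sum>c\<in>N. s c) \<in> polys_le (2 * d)" if "N \<subseteq> ?M" for N
    using that s(1) by (induction N rule: infinite_finite_induct) (auto simp: polys_le_add)
  then have "f \<in> polys_le (2 * d)"
    by (simp add: f_def)
  moreover have "f + g \<in> sos d" if g: "g \<in> polys_le (2 * d)" "norm g < 1" for g
  proof -
    have "g = (\<Sum>c\<in>?M. Poly_Mapping.single c (Poly_Mapping.lookup g c))"
      using g(1) by (intro poly_mapping_eq_sum_single finite_monom_degree_le) (simp add: polys_le_eq)
    then have "f + g = (\<Sum>c\<in>?M. s c + Poly_Mapping.single c (Poly_Mapping.lookup g c))"
      by (simp add: f_def sum.distrib)
    also have "\<dots> \<in> sos d"
    proof (intro sos_sum s(2))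
      show "\<bar>Poly_Mapping.lookup g c\<bar> \<le> 1" for c
        using norm_lookup_le[of g c] g(2) by simp
    qed
    finally show ?thesis .
  qed
  ultimately have "f \<in> int_sos d"
    unfolding int_sos_iff by (intro conjI exI[of _ 1]) auto
  then show ?thesis
    by blast
qed

text \<open>Every neighbourhood of 0 contains a negative constant, which is not a sum of squares.
  This ensures that interior points are nonzero, hence that the functional is positive on
  them.\<close>

lemma zero_notin_int_sos: "0 \<notin> int_sos d"
proof
  assume "(0 :: 'a rpoly) \<in> int_sos d"
  then obtain e where e: "0 < e" "\<And>g :: 'a rpoly. g \<in> polys_le (2 * d) \<Longrightarrow> norm g < e \<Longrightarrow> g \<in> sos d"
    unfolding int_sos_iff by auto
  let ?g = "Poly_Mapping.single 0 (- e / 2) :: 'a rpoly"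
  have "?g \<in> sos d"
    using e(1) by (intro e(2) polys_le_single)
      (auto simp: norm_poly_mapping_eq_sum[of "{0}"] split: if_splits)
  from poly_eval_sos_nonneg[OF this, of 0] e(1) show False
    by simp
qed

subsection \<open>Rank one operators\<close>

text \<open>The operator maps into the line through \<open>f\<close> and acts there as
  multiplication by \<open>t * l f\<close>, so the series is a scalar exponential apart from its
  first term.\<close>

lemma op_exp_rank_one:
  fixes l :: "'a::real_normed_vector \<Rightarrow> real"
  assumes scale: "\<And>c. l (c *\<^sub>R f) = c * l f" and "l f \<noteq> 0"
  shows "op_exp (\<lambda>p. t *\<^sub>R (l p *\<^sub>R f)) p = p + ((exp (t * l f) - 1) * l p / l f) *\<^sub>R f"
proof -
  define B where "B = (\<lambda>p. t *\<^sub>R (l p *\<^sub>R f))"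
  define g where "g = (l p / l f) *\<^sub>R f"
  have Suc: "(B ^^ Suc k) p = (t * l f) ^ Suc k *\<^sub>R g" for k
    using \<open>l f \<noteq> 0\<close> by (induction k) (simp_all add: B_def g_def scale)
  \<comment> \<open>\<open>g\<close> is the point of that line with \<open>B g = B p\<close>; the
    iterates on \<open>p\<close> and \<open>g\<close> agree from exponent 1 on, and
    \<open>p - g\<close> corrects only \<open>k = 0\<close>.\<close>
  have "(B ^^ k) p = (t * l f) ^ k *\<^sub>R g + (if k = 0 then p - g else 0)" for k
    using Suc by (cases k) auto
  moreover have "(\<lambda>k. ((t * l f) ^ k / fact k) *\<^sub>R g + (if k = 0 then p - g else 0)) sums
      (exp (t * l f) *\<^sub>R g + (p - g))"
    using exp_converges[of "t * l f"]
    by (intro sums_add bounded_linear.sums[OF bounded_linear_scaleR_left] sums_single[of 0 "\<lambda>_. p - g"])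
      (simp add: divide_inverse mult.commute)
  moreover have "(1 / fact k) *\<^sub>R ((t * l f) ^ k *\<^sub>R g + (if k = 0 then p - g else 0))
      = ((t * l f) ^ k / fact k) *\<^sub>R g + (if k = 0 then p - g else 0)" for k
    by (simp add: scaleR_add_right)
  ultimately have "op_exp B p = exp (t * l f) *\<^sub>R g + (p - g)"
    unfolding op_exp_def by (simp add: sums_iff)
  also have "\<dots> = p + (exp (t * l f) - 1) *\<^sub>R g"
    by (simp add: algebra_simps)
  finally show ?thesis
    by (simp add: B_def g_def)
qed

lemma gauss_operator_moves_into_sos:
  fixes K :: "(real ^ 'n::finite) set"
  assumes K: "closed K" "interior K \<noteq> {}" and S: "S \<subseteq> Pos_le K (2 * d)" and f: "f \<in> int_sos d"
  shows "\<exists>\<tau>. moves_into_sos d S (\<lambda>p. gauss_functional K p *\<^sub>R f) \<tau>"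
proof -
  let ?V = "polys_le (2 * d)"
  let ?l = "gauss_functional K"
  obtain e where fV: "f \<in> ?V" and e: "0 < e" "\<And>g. g \<in> ?V \<Longrightarrow> norm g < e \<Longrightarrow> f + g \<in> sos d"
    using f unfolding int_sos_iff by blast
  have "f \<in> sos d"
    using e(2)[of 0] e(1) by simp
  then have lf: "0 < ?l f"
    using f zero_notin_int_sos poly_eval_sos_nonneg by (intro gauss_functional_pos[OF K]) blast+
  obtain C where C: "0 < C" "\<And>p. p \<in> Pos_le K (2 * d) \<Longrightarrow> norm p \<le> C * ?l p"
    using Pos_le_norm_le_gauss_functional[OF K] by blast
  have lin: "linear_on ?V ?V (\<lambda>p. ?l p *\<^sub>R f)"
    using fV by (auto simp: linear_on_def gauss_functional_add[OF K(1)] gauss_functional_scaleR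
        scaleR_add_left polys_le_scaleR)
  \<comment> \<open>The threshold \<open>C / e\<close> would give only a weak inequality; the factor
    2 yields the strict \<open>C < c * e\<close> needed for an open ball.\<close>
  define \<tau> where "\<tau> = 2 * C / e"
  have "op_exp (\<lambda>p. t *\<^sub>R (?l p *\<^sub>R f)) p \<in> sos d" if t: "\<tau> \<le> t" and "p \<in> S" for t p
  proof -
    have p: "p \<in> Pos_le K (2 * d)"
      using \<open>p \<in> S\<close> S by blast
    define c where "c = (exp (t * ?l f) - 1) / ?l f"
    have "t \<le> c"
      using exp_ge_add_one_self[of "t * ?l f"] lf by (simp add: c_def field_simps)
    moreover have "0 < \<tau>"
      using C(1) e(1) by (simp add: \<tau>_def)
    ultimately have c: "0 < c" "2 * C / e \<le> c"
      using t by (auto simp: \<tau>_def)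
    then have "C < c * e"
      using C(1) e(1) by (simp add: field_simps)
    have exp: "op_exp (\<lambda>p. t *\<^sub>R (?l p *\<^sub>R f)) p = p + (c * ?l p) *\<^sub>R f"
      using lf by (subst op_exp_rank_one) (simp_all add: gauss_functional_scaleR c_def)
    show ?thesis
    proof (cases "p = 0")
      \<comment> \<open>Here \<open>?l p = 0\<close>, so division by \<open>c * ?l p\<close> is
        impossible; the exponential simply fixes 0.\<close>
      case True
      then show ?thesis
        using exp gauss_functional_scaleR[of K 0 0] by (simp add: sos_zero)
    next
      case False
      then have lp: "0 < ?l p"
        using p by (intro gauss_functional_pos[OF K]) (auto simp: Pos_le_def)
      define r where "r = c * ?l p"
      have r: "0 < r"
        using c lp by (simp add: r_def)
      have "norm p \<le> C * ?l p"
        by (rule C(2)[OF p])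
      also have "\<dots> < c * e * ?l p"
        using \<open>C < c * e\<close> lp by (rule mult_strict_right_mono)
      finally have "norm (inverse r *\<^sub>R p) < e"
        using r by (simp add: r_def field_simps)
      then have "f + inverse r *\<^sub>R p \<in> sos d"
        using p by (intro e(2) polys_le_scaleR) (auto simp: Pos_le_def)
      then have "r *\<^sub>R (f + inverse r *\<^sub>R p) \<in> sos d"
        using r by (intro sos_scaleR) auto
      also have "r *\<^sub>R (f + inverse r *\<^sub>R p) = p + r *\<^sub>R f"
        using r by (simp add: scaleR_add_right)
      finally show ?thesis
        by (simp only: exp r_def)
    qed
  qed
  moreover have "0 \<le> \<tau>"
    using C(1) e(1) by (simp add: \<tau>_def)
  ultimately show ?thesis
    using lin unfolding moves_into_sos_def by blast
qed

section \<open>Inverse exponential on bounded degree and assembly of the three claims\<close>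

lemma op_exp_uminus_cancel_polys_le:
  assumes A: "linear_on (polys_le m) (polys_le m) A" and p: "p \<in> polys_le m"
  shows "op_exp (\<lambda>q. (- t) *\<^sub>R A q) (op_exp (\<lambda>q. t *\<^sub>R A q) p) = p"
proof -
  have "linear_on (polys_le m) (polys_le m) (\<lambda>q. t *\<^sub>R A q)"
    using A by (auto simp: linear_on_def scaleR_add_right polys_le_scaleR image_subset_iff)
  then show ?thesis
    using op_exp_uminus_cancel[OF finite_monom_degree_le, of m "\<lambda>q. t *\<^sub>R A q" p] p
    by (simp add: polys_le_eq)
qed

theorem corollary7p3:
  fixes K :: "(real ^ 'n::finite) set" and d :: nat and S :: "'n rpoly set"
  assumes "closed K" and "interior K \<noteq> {}" and "S \<subseteq> Pos_le K (2 * d)"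
  shows
    "(\<exists>A \<tau>. moves_into_sos d S A \<tau>) \<and>
     (\<forall>f \<in> int_sos d. \<exists>\<tau>. moves_into_sos d S (\<lambda>p. gauss_functional K p *\<^sub>R f) \<tau>) \<and>
     (\<forall>L A \<tau>. linear_on (polys_le (2 * d)) (UNIV :: real set) L \<longrightarrow> moves_into_sos d S A \<tau> \<longrightarrow>
        (let S' = op_exp (\<lambda>p. \<tau> *\<^sub>R A p) ` S;
             L' = (\<lambda>p. L (op_exp (\<lambda>q. (- \<tau>) *\<^sub>R A q) p))
         in S' \<subseteq> sos d \<and>
            (INF p\<in>S. ereal (L p)) = (INF p\<in>S'. ereal (L' p)) \<and>
            (SUP p\<in>S. ereal (L p)) = (SUP p\<in>S'. ereal (L' p))))"
proof (intro conjI ballI allI impI)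
  show gauss: "\<exists>\<tau>. moves_into_sos d S (\<lambda>p. gauss_functional K p *\<^sub>R f) \<tau>" if "f \<in> int_sos d" for f
    using gauss_operator_moves_into_sos[OF assms that] .
  \<comment> \<open>Claim (i) follows from (ii) applied to any interior point of the cone.\<close>
  then show "\<exists>A \<tau>. moves_into_sos d S A \<tau>"
    using int_sos_nonempty by blast
  fix L :: "'n rpoly \<Rightarrow> real" and A \<tau>
  assume A: "moves_into_sos d S A \<tau>"
  \<comment> \<open>By this cancellation \<open>L'\<close> takes at the image of \<open>p\<close>
    the value \<open>L p\<close>, so both extrema range over the same set of values.\<close>
  have "op_exp (\<lambda>q. (- \<tau>) *\<^sub>R A q) (op_exp (\<lambda>q. \<tau> *\<^sub>R A q) p) = p" if "p \<in> S" for p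
    using A assms(3) that
    by (intro op_exp_uminus_cancel_polys_le) (auto simp: moves_into_sos_def Pos_le_def)
  moreover have "op_exp (\<lambda>p. \<tau> *\<^sub>R A p) ` S \<subseteq> sos d"
    using A by (simp add: moves_into_sos_def)
  ultimately show "let S' = op_exp (\<lambda>p. \<tau> *\<^sub>R A p) ` S;
             L' = (\<lambda>p. L (op_exp (\<lambda>q. (- \<tau>) *\<^sub>R A q) p))
         in S' \<subseteq> sos d \<and>
            (INF p\<in>S. ereal (L p)) = (INF p\<in>S'. ereal (L' p)) \<and>
            (SUP p\<in>S. ereal (L p)) = (SUP p\<in>S'. ereal (L' p))"
    \<comment> \<open>The deleted rule would move the sign out of
      \<open>(- \<tau>) *\<^sub>R A q\<close> and hide the match with the cancellation fact.\<close>
    by (simp add: Let_def image_image del: scaleR_minus_left)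
qed

end
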